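(* For all integers $k\ge 1$, $m\ge 1$, $n\ge 1$ and $k_1,\ldots,k_m\ge 1$, $$t(F^kM^{k_1,k_2,\ldots,k_m}K_{m,n})=(k_1+k_2+\cdots+k_m)^{n-1}\,k\,\Big(\prod_{i=1}^m(k+k_in)\Big)\sum_{i=1}^m\frac{k_i}{k+k_in}.$$ In particular, if $k_i=s$ for every $i=1,\ldots,m$, then $$t(F^kM^{s,s,\ldots,s}K_{m,n})=s^n m^n k\,(k+sn)^{m-1}.$$
   Context: Graphs may have multiple edges; $t(G)$ denotes the number of spanning trees of $G$, with parallel edges distinguished. The generalized complete bipartite graph $M^{k_1,\ldots,k_m}K_{m,n}$ has vertex set $V_1\cup V_2$ with $V_1=\{p_1,\ldots,p_n\}$ and $V_2=\{q_1,\ldots,q_m\}$, where for each $i\in\{1,\ldots,m\}$ and $j\in\{1,\ldots,n\}$ the vertices $q_i$ and $p_j$ are joined by exactly $k_i$ parallel edges and there are no other edges. The generalized half cone $F^kM^{k_1,\ldots,k_m}K_{m,n}$ is obtained from $M^{k_1,\ldots,k_m}K_{m,n}$ by adding a new vertex $p$ and joining $p$ to each $q_j$ ($j=1,\ldots,m$) by exactly $k$ parallel edges. *)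

theory Defs
  imports Complex_Main
begin

record ('v, 'e) multigraph =
  verts :: "'v set"
  edges :: "'e set"
  ends :: "'e \<Rightarrow> 'v set"

definition adj_rel :: "('v, 'e) multigraph \<Rightarrow> ('v \<times> 'v) set" where
  "adj_rel G = {(u, v). u \<in> verts G \<and> v \<in> verts G \<and> (\<exists>e \<in> edges G. ends G e = {u, v})}"

definition mg_connected :: "('v, 'e) multigraph \<Rightarrow> bool" where
  "mg_connected G \<longleftrightarrow>
     verts G \<noteq> {} \<and> (\<forall>u \<in> verts G. \<forall>v \<in> verts G. (u, v) \<in> (adj_rel G)\<^sup>*)"

text \<open>
  The closed walk \<open>v\<^sub>0 e\<^sub>0 v\<^sub>1 e\<^sub>1 \<dots> v\<^sub>0\<close> with pairwise distinct vertices and pairwise distinct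
  edges. Two different parallel edges form a cycle of length 2, while traversing one edge back and
  forth does not.
\<close>

definition is_cycle :: "('v, 'e) multigraph \<Rightarrow> 'v list \<Rightarrow> 'e list \<Rightarrow> bool" where
  "is_cycle G vs es \<longleftrightarrow>
     es \<noteq> [] \<and> length vs = length es \<and> distinct vs \<and> distinct es \<and>
     set vs \<subseteq> verts G \<and> set es \<subseteq> edges G \<and>
     (\<forall>i < length es. ends G (es ! i) = {vs ! i, vs ! (Suc i mod length es)})"

definition is_tree :: "('v, 'e) multigraph \<Rightarrow> bool" where
  "is_tree G \<longleftrightarrow> mg_connected G \<and> \<not> (\<exists>vs es. is_cycle G vs es)"

text \<open>
  A spanning subgraph keeps all vertices, so a spanning tree is given by its set of edges.
\<close>

definition spanning_trees :: "('v, 'e) multigraph \<Rightarrow> 'e set set" where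
  "spanning_trees G = {T. T \<subseteq> edges G \<and> is_tree (G\<lparr>edges := T\<rparr>)}"

definition num_spanning_trees :: "('v, 'e) multigraph \<Rightarrow> nat" where
  "num_spanning_trees G = card (spanning_trees G)"

datatype vertex = P nat | Q nat | Apex

text \<open>
  The edge \<open>(u, v, l)\<close> is the \<open>l\<close>-th of the parallel edges joining \<open>u\<close> and \<open>v\<close>. Every pair of
  vertices is used in one order only: \<open>(Q i, P j, l)\<close> and \<open>(Apex, Q i, l)\<close>.
\<close>

type_synonym edge = "vertex \<times> vertex \<times> nat"

definition gen_complete_bipartite ::
    "(nat \<Rightarrow> nat) \<Rightarrow> nat \<Rightarrow> nat \<Rightarrow> (vertex, edge) multigraph" where
  "gen_complete_bipartite ks m n =
     \<lparr> verts = P ` {1..n} \<union> Q ` {1..m},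
       edges = {(Q i, P j, l) | i j l. i \<in> {1..m} \<and> j \<in> {1..n} \<and> l \<in> {1..ks i}},
       ends = (\<lambda>(u, v, l). {u, v}) \<rparr>"

definition gen_half_cone ::
    "nat \<Rightarrow> (nat \<Rightarrow> nat) \<Rightarrow> nat \<Rightarrow> nat \<Rightarrow> (vertex, edge) multigraph" where
  "gen_half_cone k ks m n =
     (let G = gen_complete_bipartite ks m n in
      G\<lparr> verts := insert Apex (verts G),
         edges := edges G \<union> {(Apex, Q i, l) | i l. i \<in> {1..m} \<and> l \<in> {1..k}} \<rparr>)"

end

theory Submission
  imports Defs
begin

text \<open>
  A connected multigraph is a tree iff it is minimally connected, and minimal connectivity passes
  to the contraction of an edge; hence the number of spanning trees satisfies deletion-contraction.
  Contracting only edges at the apex, every graph that arises is again a complete bipartite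
  graph on parts \<open>A\<close>, \<open>B\<close> with \<open>K i\<close> parallel edges at \<open>i \<in> A\<close>, together with a root joined to each
  other vertex \<open>u\<close> by an arbitrary number \<open>x u\<close> of edges. Its reduced Laplacian is a diagonal
  matrix plus an off-diagonal block of rank one, which suggests the closed formula
  \<open>\<Prod>d\<^sub>i \<Prod>e\<^sub>j (1 - (\<Sum>K\<^sub>i\<^sup>2 / d\<^sub>i) (\<Sum>1 / e\<^sub>j))\<close> with \<open>d\<^sub>i = x\<^sub>i + K\<^sub>i |B|\<close>, \<open>e\<^sub>j = x\<^sub>j + \<Sum>K\<close>.
  No determinants are needed: the formula is checked directly against the recursion.
\<close>

section \<open>Deletion, contraction and edge multiplicity\<close>

definition wf_multigraph :: "('v, 'e) multigraph \<Rightarrow> bool" where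
  "wf_multigraph G \<longleftrightarrow> (\<forall>e \<in> edges G. \<exists>u \<in> verts G. \<exists>v \<in> verts G. ends G e = {u, v})"

definition del_edge :: "'e \<Rightarrow> ('v, 'e) multigraph \<Rightarrow> ('v, 'e) multigraph" where
  "del_edge e G = G\<lparr>edges := edges G - {e}\<rparr>"

definition merge :: "'v \<Rightarrow> 'v \<Rightarrow> 'v \<Rightarrow> 'v" where
  "merge r v x = (if x = v then r else x)"

text \<open>Edges keep their names and \<open>r\<close> stands for the merged vertex, so a spanning
  tree of the contraction is an edge set of \<open>G\<close> avoiding \<open>e\<close>. Edges
  parallel to \<open>e\<close> survive as loops at \<open>r\<close>; \<open>wf_multigraph\<close>
  admits loops.\<close>

definition contract :: "'v \<Rightarrow> 'v \<Rightarrow> 'e \<Rightarrow> ('v, 'e) multigraph \<Rightarrow> ('v, 'e) multigraph" where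
  "contract r v e G =
     \<lparr>verts = verts G - {v}, edges = edges G - {e}, ends = (\<lambda>f. merge r v ` ends G f)\<rparr>"

definition mult :: "('v, 'e) multigraph \<Rightarrow> 'v \<Rightarrow> 'v \<Rightarrow> nat" where
  "mult G u v = card {e \<in> edges G. ends G e = {u, v}}"

lemma del_edge_simps [simp]:
  "verts (del_edge e G) = verts G" "edges (del_edge e G) = edges G - {e}"
  "ends (del_edge e G) = ends G"
  by (simp_all add: del_edge_def)

lemma contract_simps [simp]:
  "verts (contract r v e G) = verts G - {v}" "edges (contract r v e G) = edges G - {e}"
  "ends (contract r v e G) f = merge r v ` ends G f"
  by (simp_all add: contract_def)

section \<open>Minimal connectivity and contraction\<close>

lemma sym_adj_rel_rtrancl: "(u, v) \<in> (adj_rel G)\<^sup>* \<Longrightarrow> (v, u) \<in> (adj_rel G)\<^sup>*"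
proof -
  have "sym (adj_rel G)"
    by (auto simp: sym_def adj_rel_def insert_commute)
  then show "(u, v) \<in> (adj_rel G)\<^sup>* \<Longrightarrow> (v, u) \<in> (adj_rel G)\<^sup>*"
    by (meson symD sym_rtrancl)
qed

text \<open>The detour between \<open>a\<close> and \<open>b\<close> replaces \<open>f\<close>
  wherever a walk uses it.\<close>

lemma connected_del_edge:
  assumes "mg_connected G" "ends G f = {a, b}" "(a, b) \<in> (adj_rel (del_edge f G))\<^sup>*"
  shows "mg_connected (del_edge f G)"
proof -
  have "adj_rel G \<subseteq> (adj_rel (del_edge f G))\<^sup>*"
  proof (rule subrelI)
    fix x y assume xy: "(x, y) \<in> adj_rel G"
    then obtain e where e: "x \<in> verts G" "y \<in> verts G" "e \<in> edges G" "ends G e = {x, y}"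
      by (auto simp: adj_rel_def)
    show "(x, y) \<in> (adj_rel (del_edge f G))\<^sup>*"
    proof (cases "e = f")
      case True
      then have "x = a \<and> y = b \<or> x = b \<and> y = a"
        using e assms(2) by (auto simp: doubleton_eq_iff)
      then show ?thesis
        using assms(3) sym_adj_rel_rtrancl by metis
    next
      case False
      then have "(x, y) \<in> adj_rel (del_edge f G)"
        using e by (auto simp: adj_rel_def)
      then show ?thesis by blast
    qed
  qed
  then have "(adj_rel G)\<^sup>* \<subseteq> (adj_rel (del_edge f G))\<^sup>*"
    by (rule rtrancl_subset_rtrancl)
  then show ?thesis
    using assms(1) by (auto simp: mg_connected_def)
qed

text \<open>The rest of the cycle is a detour around \<open>f\<close>.\<close>

lemma connected_del_cycle_edge:
  assumes "mg_connected G" "is_cycle G vs es" "f \<in> set es"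
  shows "mg_connected (del_edge f G)"
proof -
  let ?n = "length es"
  obtain i where i: "i < ?n" "f = es ! i"
    using assms(3) by (metis in_set_conv_nth)
  have n: "?n > 0" using i by linarith
  have c: "length vs = ?n" "distinct es" "set vs \<subseteq> verts G" "set es \<subseteq> edges G"
    "\<And>i. i < ?n \<Longrightarrow> ends G (es ! i) = {vs ! i, vs ! (Suc i mod ?n)}"
    using assms(2) by (auto simp: is_cycle_def)
  \<comment> \<open>The walk starts right after \<open>f\<close>; after \<open>?n - 1\<close> steps
    it arrives at \<open>vs ! i\<close>, the other end of \<open>f\<close>.\<close>
  have walk: "(vs ! (Suc i mod ?n), vs ! ((Suc i + j) mod ?n)) \<in> (adj_rel (del_edge f G))\<^sup>*"
    if "j \<le> ?n - 1" for j
    using that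
  proof (induction j)
    case 0
    then show ?case by simp
  next
    case (Suc j)
    let ?k = "(Suc i + j) mod ?n"
    have k: "?k < ?n" using n by simp
    \<comment> \<open>The walk is back at position \<open>i\<close> only if \<open>?n\<close>
      divides \<open>Suc j\<close>, but \<open>Suc j\<close> is positive and below
      \<open>?n\<close>.\<close>
    have "?k \<noteq> i"
    proof
      assume "?k = i"
      then have "(Suc j + i) mod ?n = i mod ?n"
        using i by (simp add: add.commute)
      then have "?n dvd Suc j"
        by (simp add: mod_eq_dvd_iff_nat)
      then show False using Suc.prems n by (auto dest: dvd_imp_le)
    qed
    then have "es ! ?k \<noteq> f"
      using i k c(2) by (simp add: nth_eq_iff_index_eq)
    moreover have "es ! ?k \<in> edges G" "vs ! ?k \<in> verts G" "vs ! (Suc ?k mod ?n) \<in> verts G"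
      using k c(1,3,4) n by (metis nth_mem subsetD mod_less_divisor)+
    ultimately have "(vs ! ?k, vs ! (Suc ?k mod ?n)) \<in> adj_rel (del_edge f G)"
      using c(5)[OF k] unfolding adj_rel_def by force
    moreover have "Suc ?k mod ?n = (Suc i + Suc j) mod ?n"
      by (simp add: mod_Suc_eq)
    ultimately have "(vs ! ?k, vs ! ((Suc i + Suc j) mod ?n)) \<in> adj_rel (del_edge f G)"
      by metis
    with Suc show ?case
      by (meson Suc_leD rtrancl.rtrancl_into_rtrancl)
  qed
  have "(Suc i + (?n - 1)) mod ?n = i" using i n by simp
  with walk[of "?n - 1"] have "(vs ! (Suc i mod ?n), vs ! i) \<in> (adj_rel (del_edge f G))\<^sup>*"
    by simp
  moreover have "ends G f = {vs ! (Suc i mod ?n), vs ! i}"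
    using c(5)[OF i(1)] i(2) by auto
  ultimately show ?thesis
    using connected_del_edge[OF assms(1)] by blast
qed

text \<open>The path grows backwards from \<open>v\<close>: a new first vertex is prepended or, if
  the path already visits it, the part before that visit is cut off.\<close>

lemma simple_path_if_reachable:
  assumes "(u, v) \<in> (adj_rel G)\<^sup>*" "v \<in> verts G"
  shows "\<exists>vs es. length vs = Suc (length es) \<and> vs ! 0 = u \<and> vs ! length es = v \<and> distinct vs \<and>
    set vs \<subseteq> verts G \<and> set es \<subseteq> edges G \<and>
    (\<forall>i < length es. ends G (es ! i) = {vs ! i, vs ! Suc i})"
  using assms(1)
proof (induction rule: converse_rtrancl_induct)
  case base
  show ?case
    using assms(2) by (intro exI[of _ "[v]"] exI[of _ "[]"]) auto
next
  case (step u w)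
  then obtain vs es where p: "length vs = Suc (length es)" "vs ! 0 = w" "vs ! length es = v"
    "distinct vs" "set vs \<subseteq> verts G" "set es \<subseteq> edges G"
    "\<And>i. i < length es \<Longrightarrow> ends G (es ! i) = {vs ! i, vs ! Suc i}"
    by blast
  obtain e where e: "e \<in> edges G" "ends G e = {u, w}" "u \<in> verts G"
    using step(1) by (auto simp: adj_rel_def)
  show ?case
  proof (cases "u \<in> set vs")
    case True
    then obtain i where i: "i < length vs" "vs ! i = u"
      by (metis in_set_conv_nth)
    show ?thesis
      using p i set_drop_subset[of i vs] set_drop_subset[of i es]
      by (intro exI[of _ "drop i vs"] exI[of _ "drop i es"]) auto
  next
    case False
    have "ends G ((e # es) ! i) = {(u # vs) ! i, (u # vs) ! Suc i}" if "i < length (e # es)" for i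
      using that e p by (cases i) auto
    then show ?thesis
      using p e False by (intro exI[of _ "u # vs"] exI[of _ "e # es"]) auto
  qed
qed

text \<open>A simple path from \<open>u\<close> to \<open>v\<close> avoiding \<open>e\<close> is
  closed up by \<open>e\<close>. If \<open>e\<close> is a loop, that path has no edge and the cycle
  is \<open>e\<close> alone; hence a second edge is claimed only for distinct ends.\<close>

lemma cycle_through_non_bridge:
  assumes "mg_connected (del_edge e G)" "e \<in> edges G" "ends G e = {u, v}"
    "u \<in> verts G" "v \<in> verts G"
  shows "\<exists>vs es. is_cycle G vs es \<and> e \<in> set es \<and> (u \<noteq> v \<longrightarrow> (\<exists>f \<in> set es. f \<noteq> e))"
proof -
  have "(u, v) \<in> (adj_rel (del_edge e G))\<^sup>*"
    using assms by (auto simp: mg_connected_def)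
  from simple_path_if_reachable[OF this] obtain vs es where
    p: "length vs = Suc (length es)" "vs ! 0 = u" "vs ! length es = v"
    "distinct vs" "set vs \<subseteq> verts G" "set es \<subseteq> edges G - {e}"
    "\<And>i. i < length es \<Longrightarrow> ends G (es ! i) = {vs ! i, vs ! Suc i}"
    using assms by auto
  \<comment> \<open>On a path with distinct vertices, a pair of consecutive vertices determines its
    position, so no edge repeats.\<close>
  have "distinct es"
    unfolding distinct_conv_nth
  proof (intro allI impI notI)
    fix i j assume ij: "i < length es" "j < length es" "i \<noteq> j" "es ! i = es ! j"
    then have "{vs ! i, vs ! Suc i} = {vs ! j, vs ! Suc j}"
      using p(7) by metis
    then show False
      using ij p(1,4) by (auto simp: doubleton_eq_iff nth_eq_iff_index_eq)
  qed
  \<comment> \<open>At the last index the modulus wraps around to \<open>vs ! 0 = u\<close>, where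
    \<open>e\<close> closes the path.\<close>
  moreover have "ends G ((es @ [e]) ! i) = {vs ! i, vs ! (Suc i mod length (es @ [e]))}"
    if "i < length (es @ [e])" for i
    using that p assms(3) by (cases "i = length es") (auto simp: nth_append)
  ultimately have "is_cycle G vs (es @ [e])"
    using p assms(2) unfolding is_cycle_def by auto
  moreover have "\<exists>f \<in> set (es @ [e]). f \<noteq> e" if "u \<noteq> v"
  proof -
    have "es \<noteq> []" using that p(2,3) by auto
    then show ?thesis using p(6) by (cases es) auto
  qed
  ultimately show ?thesis by (metis in_set_conv_decomp)
qed

text \<open>An edge on a cycle can be deleted, and a deletable edge lies on a cycle. This trades
  cycles, which are awkward to trace through a contraction, for connectivity.\<close>

lemma is_tree_iff_minimally_connected:
  assumes "wf_multigraph G"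
  shows "is_tree G \<longleftrightarrow> mg_connected G \<and> (\<forall>e \<in> edges G. \<not> mg_connected (del_edge e G))"
proof -
  have "\<exists>e \<in> edges G. mg_connected (del_edge e G)" if "mg_connected G" "is_cycle G vs es" for vs es
  proof -
    have "hd es \<in> set es" "set es \<subseteq> edges G"
      using that(2) by (auto simp: is_cycle_def)
    then show ?thesis
      using connected_del_cycle_edge[OF that] by blast
  qed
  moreover have "\<exists>vs es. is_cycle G vs es" if "e \<in> edges G" "mg_connected (del_edge e G)" for e
    using that assms cycle_through_non_bridge unfolding wf_multigraph_def by metis
  ultimately show ?thesis
    unfolding is_tree_def by blast
qed

lemma wf_contract:
  assumes "wf_multigraph G" "r \<in> verts G" "r \<noteq> v"
  shows "wf_multigraph (contract r v e G)"
  unfolding wf_multigraph_def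
proof
  fix f assume "f \<in> edges (contract r v e G)"
  then obtain a b where ab: "a \<in> verts G" "b \<in> verts G" "ends G f = {a, b}"
    using assms(1) by (auto simp: wf_multigraph_def)
  have "merge r v x \<in> verts (contract r v e G)" if "x \<in> verts G" for x
    using that assms by (simp add: merge_def)
  moreover have "ends (contract r v e G) f = {merge r v a, merge r v b}"
    using ab by simp
  ultimately show "\<exists>a \<in> verts (contract r v e G). \<exists>b \<in> verts (contract r v e G).
      ends (contract r v e G) f = {a, b}"
    using ab by blast
qed

text \<open>Walks project along \<open>merge\<close>, with \<open>e\<close> collapsing to a point.
  Conversely, each edge of the contraction lifts to \<open>G\<close>, where \<open>e\<close> links
  \<open>v\<close> to its image \<open>r\<close>.\<close>

lemma connected_contract:
  assumes wf: "wf_multigraph G" and rv: "r \<in> verts G" "v \<in> verts G" "r \<noteq> v"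
    and e: "e \<in> edges G" "ends G e = {r, v}"
  shows "mg_connected (contract r v e G) \<longleftrightarrow> mg_connected G"
proof
  let ?C = "contract r v e G" and ?p = "merge r v"
  have p: "?p x \<in> verts ?C" if "x \<in> verts G" for x
    using that rv by (auto simp: merge_def)
  have fwd: "(?p x, ?p y) \<in> (adj_rel ?C)\<^sup>*" if "(x, y) \<in> (adj_rel G)\<^sup>*" for x y
    using that
  proof (induction rule: rtrancl_induct)
    case (step y z)
    then obtain f where f: "y \<in> verts G" "z \<in> verts G" "f \<in> edges G" "ends G f = {y, z}"
      by (auto simp: adj_rel_def)
    have "(?p y, ?p z) \<in> (adj_rel ?C)\<^sup>*"
    proof (cases "f = e")
      case True
      then have "?p y = ?p z"
        using f e by (auto simp: doubleton_eq_iff merge_def)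
      then show ?thesis by simp
    next
      case False
      then have "(?p y, ?p z) \<in> adj_rel ?C"
        using f p[of y] p[of z] by (auto simp: adj_rel_def intro!: bexI[of _ f])
      then show ?thesis by blast
    qed
    with step show ?case by (meson rtrancl_trans)
  qed simp
  have to_p: "(x, ?p x) \<in> (adj_rel G)\<^sup>*" for x
  proof (cases "x = v")
    case True
    have "(v, r) \<in> adj_rel G" using e rv by (auto simp: adj_rel_def)
    then show ?thesis using True by (auto simp: merge_def)
  qed (simp add: merge_def)
  have bwd: "(x, y) \<in> (adj_rel G)\<^sup>*" if "(x, y) \<in> (adj_rel ?C)\<^sup>*" for x y
    using that
  proof (induction rule: rtrancl_induct)
    case (step y z)
    then obtain f where f: "f \<in> edges G" "?p ` ends G f = {y, z}"
      by (auto simp: adj_rel_def)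
    obtain a b where ab: "a \<in> verts G" "b \<in> verts G" "ends G f = {a, b}"
      using wf f by (auto simp: wf_multigraph_def)
    then have "(a, b) \<in> adj_rel G" using f by (auto simp: adj_rel_def)
    then have "(?p a, ?p b) \<in> (adj_rel G)\<^sup>*"
      using to_p by (meson r_into_rtrancl rtrancl_trans sym_adj_rel_rtrancl)
    moreover have "?p a = y \<and> ?p b = z \<or> ?p a = z \<and> ?p b = y"
      using f ab by (auto simp: doubleton_eq_iff)
    ultimately have "(y, z) \<in> (adj_rel G)\<^sup>*"
      using sym_adj_rel_rtrancl by metis
    with step show ?case by (meson rtrancl_trans)
  qed simp
  {
    assume "mg_connected ?C"
    then have "(?p x, ?p y) \<in> (adj_rel G)\<^sup>*" if "x \<in> verts G" "y \<in> verts G" for x y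
      using p that bwd by (auto simp: mg_connected_def)
    then show "mg_connected G"
      using to_p rv sym_adj_rel_rtrancl unfolding mg_connected_def
      by (metis emptyE rtrancl_trans)
  next
    assume "mg_connected G"
    then have "(?p x, ?p y) \<in> (adj_rel ?C)\<^sup>*" if "x \<in> verts G" "y \<in> verts G" for x y
      using that fwd by (auto simp: mg_connected_def)
    moreover have "?p x = x" if "x \<in> verts ?C" for x
      using that by (auto simp: merge_def)
    ultimately show "mg_connected ?C"
      using p[OF rv(1)] unfolding mg_connected_def
      by (metis contract_simps(1) Diff_iff emptyE)
  }
qed

text \<open>Deleting an edge other than \<open>e\<close> commutes with contracting \<open>e\<close>,
  so the two minimality conditions can differ only at \<open>e\<close> itself.\<close>

lemma is_tree_contract:
  assumes wf: "wf_multigraph G" and rv: "r \<in> verts G" "v \<in> verts G" "r \<noteq> v"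
    and e: "e \<in> edges G" "ends G e = {r, v}"
  shows "is_tree (contract r v e G) \<longleftrightarrow> is_tree G"
proof -
  let ?C = "contract r v e G"
  have del: "mg_connected (del_edge f ?C) \<longleftrightarrow> mg_connected (del_edge f G)"
    if "f \<in> edges G" "f \<noteq> e" for f
  proof -
    have "del_edge f ?C = contract r v e (del_edge f G)"
      by (auto simp: del_edge_def contract_def)
    moreover have "wf_multigraph (del_edge f G)"
      using wf by (auto simp: wf_multigraph_def)
    ultimately show ?thesis
      using connected_contract[of "del_edge f G" r v e] rv e that by simp
  qed
  \<comment> \<open>Deleting \<open>e\<close> itself is not visible in the contraction; but if \<open>e\<close> is not a bridge, then neither
    is another edge of a cycle through \<open>e\<close>.\<close>
  have "\<exists>f \<in> edges G. f \<noteq> e \<and> mg_connected (del_edge f G)"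
    if conn: "mg_connected G" "mg_connected (del_edge e G)"
  proof -
    obtain vs es f where "is_cycle G vs es" "f \<in> set es" "f \<noteq> e"
      using cycle_through_non_bridge[OF conn(2) e rv(1,2)] rv(3) by blast
    then show ?thesis
      using connected_del_cycle_edge[OF conn(1)] by (auto simp: is_cycle_def)
  qed
  then show ?thesis
    using is_tree_iff_minimally_connected[OF wf] del connected_contract[OF assms]
      is_tree_iff_minimally_connected[OF wf_contract[OF wf rv(1,3), of e]]
    by (auto 4 3)
qed

text \<open>Spanning trees avoiding \<open>e\<close> are those of the deletion; removing
  \<open>e\<close> from the others gives those of the contraction.\<close>

theorem num_spanning_trees_del_contract:
  assumes fin: "finite (edges G)" and wf: "wf_multigraph G"
    and rv: "r \<in> verts G" "v \<in> verts G" "r \<noteq> v"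
    and e: "e \<in> edges G" "ends G e = {r, v}"
  shows "num_spanning_trees G =
    num_spanning_trees (del_edge e G) + num_spanning_trees (contract r v e G)"
proof -
  let ?D = "spanning_trees (del_edge e G)" and ?C = "spanning_trees (contract r v e G)"
  have tree: "is_tree ((contract r v e G)\<lparr>edges := T\<rparr>) \<longleftrightarrow> is_tree (G\<lparr>edges := insert e T\<rparr>)"
    if "T \<subseteq> edges G - {e}" for T
  proof -
    have "(contract r v e G)\<lparr>edges := T\<rparr> = contract r v e (G\<lparr>edges := insert e T\<rparr>)"
      using that by (auto simp: contract_def)
    moreover have "wf_multigraph (G\<lparr>edges := insert e T\<rparr>)"
      using wf that e(1) by (auto simp: wf_multigraph_def)
    ultimately show ?thesis
      using is_tree_contract[of "G\<lparr>edges := insert e T\<rparr>" r v e] rv e by simp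
  qed
  have "spanning_trees G = ?D \<union> insert e ` ?C"
  proof (intro equalityI subsetI)
    fix T assume T: "T \<in> spanning_trees G"
    show "T \<in> ?D \<union> insert e ` ?C"
    proof (cases "e \<in> T")
      case True
      then have "insert e (T - {e}) = T" by blast
      then have "T - {e} \<in> ?C"
        using T tree[of "T - {e}"] by (auto simp: spanning_trees_def)
      then show ?thesis
        using \<open>insert e (T - {e}) = T\<close> by (metis UnI2 imageI)
    next
      case False
      then show ?thesis
        using T by (auto simp: spanning_trees_def del_edge_def)
    qed
  next
    fix T assume "T \<in> ?D \<union> insert e ` ?C"
    then show "T \<in> spanning_trees G"
      using tree e by (auto simp: spanning_trees_def del_edge_def)
  qed
  moreover have "?D \<inter> insert e ` ?C = {}"
    by (auto simp: spanning_trees_def)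
  moreover have "finite ?D" "finite ?C"
    using fin by (auto simp: spanning_trees_def intro: finite_subset[of _ "Pow (edges G)"])
  moreover have "inj_on (insert e) ?C"
    by (rule inj_onI) (auto simp: spanning_trees_def insert_ident subset_iff)
  ultimately show ?thesis
    by (simp add: num_spanning_trees_def card_Un_disjoint card_image)
qed

section \<open>Edge multiplicities\<close>

lemma mult_sym: "mult G u v = mult G v u"
  by (simp add: mult_def insert_commute)

lemma mult_del_edge:
  assumes "finite (edges G)" "e \<in> edges G" "ends G e = {r, v}"
  shows "mult (del_edge e G) a b = (if {a, b} = {r, v} then mult G a b - 1 else mult G a b)"
proof -
  have "{f \<in> edges (del_edge e G). ends (del_edge e G) f = {a, b}} =
      {f \<in> edges G. ends G f = {a, b}} - {e}"
    by auto
  then show ?thesis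
    using assms by (auto simp: mult_def)
qed

lemma mult_contract_other:
  assumes "ends G e = {r, v}" "{a, b} \<inter> {r, v} = {}"
  shows "mult (contract r v e G) a b = mult G a b"
proof -
  \<comment> \<open>An edge at \<open>v\<close> has an image containing \<open>r\<close>, which is
    not in \<open>{a, b}\<close>; every other edge keeps its ends.\<close>
  have "merge r v ` ends G f = {a, b} \<longleftrightarrow> ends G f = {a, b}" for f
  proof (cases "v \<in> ends G f")
    case True
    then have "r \<in> merge r v ` ends G f" by (force simp: merge_def)
    then show ?thesis using True assms(2) by auto
  next
    case False
    then have "merge r v ` ends G f = ends G f" by (force simp: merge_def)
    then show ?thesis by simp
  qed
  then have "{f \<in> edges (contract r v e G). ends (contract r v e G) f = {a, b}} =
      {f \<in> edges G. ends G f = {a, b}}"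
    using assms by auto
  then show ?thesis by (simp add: mult_def)
qed

lemma mult_contract_root:
  assumes "finite (edges G)" "wf_multigraph G" "ends G e = {r, v}" "r \<noteq> v" "u \<notin> {r, v}"
  shows "mult (contract r v e G) r u = mult G r u + mult G v u"
proof -
  have "merge r v ` ends G f = {r, u} \<longleftrightarrow> ends G f = {r, u} \<or> ends G f = {v, u}"
    if f: "f \<in> edges G" for f
  proof -
    obtain a b where ab: "ends G f = {a, b}"
      using assms(2) f by (auto simp: wf_multigraph_def)
    show ?thesis
      using assms(4,5) unfolding ab by (auto simp: merge_def doubleton_eq_iff)
  qed
  then have "{f \<in> edges (contract r v e G). ends (contract r v e G) f = {r, u}} =
      {f \<in> edges G. ends G f = {r, u}} \<union> {f \<in> edges G. ends G f = {v, u}}"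
    using assms by (auto simp: doubleton_eq_iff)
  moreover have "{f \<in> edges G. ends G f = {r, u}} \<inter> {f \<in> edges G. ends G f = {v, u}} = {}"
    using assms by (auto simp: doubleton_eq_iff)
  ultimately show ?thesis
    using assms(1) by (simp add: mult_def card_Un_disjoint)
qed

section \<open>The closed formula\<close>

text \<open>The products run over the vertex degrees, and the last factor comes from a Schur
  complement of the reduced Laplacian. If some degree is zero, the whole value is 0, whatever the
  quotients by zero are.\<close>

definition bip_count :: "'v set \<Rightarrow> 'v set \<Rightarrow> ('v \<Rightarrow> real) \<Rightarrow> ('v \<Rightarrow> real) \<Rightarrow> real" where
  "bip_count A B K x =
     (\<Prod>i\<in>A. x i + K i * card B) * (\<Prod>j\<in>B. x j + sum K A) *
     (1 - (\<Sum>i\<in>A. (K i)\<^sup>2 / (x i + K i * card B)) * (\<Sum>j\<in>B. 1 / (x j + sum K A)))"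

lemma bip_count_cong:
  assumes "\<And>u. u \<in> A \<union> B \<Longrightarrow> x u = y u"
  shows "bip_count A B K x = bip_count A B K y"
  using assms by (simp add: bip_count_def)

text \<open>With all else fixed, the formula is affine in the degree \<open>d\<close> of
  \<open>v\<close>; its slope \<open>D * E * (1 - S * R)\<close> is the value for the
  contraction.\<close>

lemma bip_count_step_left:
  assumes fin: "finite A" "finite B" and disj: "A \<inter> B = {}" and v: "v \<in> A"
    and K: "\<And>i. i \<in> A \<Longrightarrow> K i > 0" and x: "x v \<ge> 1"
  shows "bip_count A B K x = bip_count A B K (x(v := x v - 1)) +
    bip_count (A - {v}) B K (\<lambda>u. if u \<in> B then x u + K v else x u)"
proof -
  define d where "d = x v - 1 + K v * card B"
  define D where "D = (\<Prod>i\<in>A-{v}. x i + K i * card B)"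
  define E where "E = (\<Prod>j\<in>B. x j + sum K A)"
  define S where "S = (\<Sum>i\<in>A-{v}. (K i)\<^sup>2 / (x i + K i * card B))"
  define R where "R = (\<Sum>j\<in>B. 1 / (x j + sum K A))"
  have vB: "v \<notin> B" using v disj by blast
  have 1: "bip_count A B K x = (d + 1) * D * E * (1 - ((K v)\<^sup>2 / (d + 1) + S) * R)"
    unfolding bip_count_def prod.remove[OF fin(1) v] sum.remove[OF fin(1) v, of "\<lambda>i. (K i)\<^sup>2 / _ i"]
    by (simp add: d_def D_def E_def S_def R_def)
  have "(\<Prod>j\<in>B. (x(v := x v - 1)) j + sum K A) = E"
    unfolding E_def using vB by (intro prod.cong) auto
  moreover have "(\<Sum>j\<in>B. 1 / ((x(v := x v - 1)) j + sum K A)) = R"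
    unfolding R_def using vB by (intro sum.cong) auto
  moreover have "(\<Prod>i\<in>A-{v}. (x(v := x v - 1)) i + K i * card B) = D"
    unfolding D_def by (intro prod.cong) auto
  moreover have "(\<Sum>i\<in>A-{v}. (K i)\<^sup>2 / ((x(v := x v - 1)) i + K i * card B)) = S"
    unfolding S_def by (intro sum.cong) auto
  ultimately have 2: "bip_count A B K (x(v := x v - 1)) = d * D * E * (1 - ((K v)\<^sup>2 / d + S) * R)"
    unfolding bip_count_def prod.remove[OF fin(1) v] sum.remove[OF fin(1) v, of "\<lambda>i. (K i)\<^sup>2 / _ i"]
    by (simp add: d_def)
  \<comment> \<open>Each vertex of \<open>B\<close> gains \<open>K v\<close> root edges and loses as
    many to \<open>v\<close>, so its degree is unchanged.\<close>
  let ?y = "\<lambda>u. if u \<in> B then x u + K v else x u"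
  have s: "sum K A = K v + sum K (A - {v})"
    by (rule sum.remove[OF fin(1) v])
  have "(\<Prod>j\<in>B. ?y j + sum K (A - {v})) = E"
    unfolding E_def s by (intro prod.cong) auto
  moreover have "(\<Sum>j\<in>B. 1 / (?y j + sum K (A - {v}))) = R"
    unfolding R_def s by (intro sum.cong) (auto simp: add.assoc)
  moreover have "(\<Prod>i\<in>A-{v}. ?y i + K i * card B) = D"
    unfolding D_def using disj by (intro prod.cong) auto
  moreover have "(\<Sum>i\<in>A-{v}. (K i)\<^sup>2 / (?y i + K i * card B)) = S"
    unfolding S_def using disj by (intro sum.cong) auto
  ultimately have 3: "bip_count (A - {v}) B K ?y = D * E * (1 - S * R)"
    unfolding bip_count_def by simp
  \<comment> \<open>The division by \<open>d = 0\<close> in the second formula is harmless, as its factor \<open>R\<close> vanishes.\<close>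
  have "R = 0 \<or> d \<noteq> 0"
  proof (cases "B = {}")
    case False
    then have "K v * card B > 0" using K v fin by (simp add: card_gt_0_iff)
    then show ?thesis using x by (simp add: d_def)
  qed (simp add: R_def)
  moreover have "d \<ge> 0" using x K[OF v] by (simp add: d_def)
  ultimately show ?thesis
    unfolding 1 2 3 by (auto simp: field_simps)
qed

text \<open>Again the formula is affine in the degree of \<open>v\<close>, and the slope is the
  value for the contraction.\<close>

lemma bip_count_step_right:
  assumes fin: "finite A" "finite B" and disj: "A \<inter> B = {}" and v: "v \<in> B"
    and K: "\<And>i. i \<in> A \<Longrightarrow> K i > 0" and x: "x v \<ge> 1"
  shows "bip_count A B K x = bip_count A B K (x(v := x v - 1)) +
    bip_count A (B - {v}) K (\<lambda>u. if u \<in> A then x u + K u else x u)"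
proof -
  define d where "d = x v - 1 + sum K A"
  define D where "D = (\<Prod>i\<in>A. x i + K i * card B)"
  define E where "E = (\<Prod>j\<in>B-{v}. x j + sum K A)"
  define S where "S = (\<Sum>i\<in>A. (K i)\<^sup>2 / (x i + K i * card B))"
  define R where "R = (\<Sum>j\<in>B-{v}. 1 / (x j + sum K A))"
  have vA: "v \<notin> A" using v disj by blast
  have 1: "bip_count A B K x = (d + 1) * D * E * (1 - S * (1 / (d + 1) + R))"
    unfolding bip_count_def prod.remove[OF fin(2) v] sum.remove[OF fin(2) v]
    by (simp add: d_def D_def E_def S_def R_def)
  have "(\<Prod>j\<in>B-{v}. (x(v := x v - 1)) j + sum K A) = E"
    unfolding E_def by (intro prod.cong) auto
  moreover have "(\<Sum>j\<in>B-{v}. 1 / ((x(v := x v - 1)) j + sum K A)) = R"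
    unfolding R_def by (intro sum.cong) auto
  moreover have "(\<Prod>i\<in>A. (x(v := x v - 1)) i + K i * card B) = D"
    unfolding D_def using vA by (intro prod.cong) auto
  moreover have "(\<Sum>i\<in>A. (K i)\<^sup>2 / ((x(v := x v - 1)) i + K i * card B)) = S"
    unfolding S_def using vA by (intro sum.cong) auto
  ultimately have 2: "bip_count A B K (x(v := x v - 1)) = d * D * E * (1 - S * (1 / d + R))"
    unfolding bip_count_def prod.remove[OF fin(2) v] sum.remove[OF fin(2) v]
    by (simp add: d_def)
  \<comment> \<open>Each \<open>u\<close> in \<open>A\<close> gains \<open>K u\<close> root edges
    while \<open>B\<close> loses one vertex, so the degree \<open>x u + K u * card B\<close> is
    unchanged.\<close>
  let ?y = "\<lambda>u. if u \<in> A then x u + K u else x u"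
  have c: "card B = Suc (card (B - {v}))"
    using fin(2) v by (rule card.remove)
  have "(\<Prod>j\<in>B-{v}. ?y j + sum K A) = E"
    unfolding E_def using disj by (intro prod.cong) auto
  moreover have "(\<Sum>j\<in>B-{v}. 1 / (?y j + sum K A)) = R"
    unfolding R_def using disj by (intro sum.cong) auto
  moreover have "(\<Prod>i\<in>A. ?y i + K i * card (B - {v})) = D"
    unfolding D_def c by (intro prod.cong) (auto simp: algebra_simps)
  moreover have "(\<Sum>i\<in>A. (K i)\<^sup>2 / (?y i + K i * card (B - {v}))) = S"
    unfolding S_def c by (intro sum.cong) (auto simp: algebra_simps)
  ultimately have 3: "bip_count A (B - {v}) K ?y = D * E * (1 - S * R)"
    unfolding bip_count_def by simp
  \<comment> \<open>If \<open>d = 0\<close>, then \<open>A\<close> is empty, so the spurious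
    quotient \<open>1 / d\<close> is multiplied by zero.\<close>
  have "S = 0 \<or> d \<noteq> 0"
  proof (cases "A = {}")
    case False
    then have "sum K A > 0" using K fin by (simp add: sum_pos)
    then show ?thesis using x by (simp add: d_def)
  qed (simp add: S_def)
  moreover have "d \<ge> 0" using x K by (simp add: d_def sum_nonneg less_imp_le)
  ultimately show ?thesis
    unfolding 1 2 3 by (auto simp: field_simps)
qed

text \<open>If both parts are nonempty, the two sums are \<open>sum K A / card B\<close> and its
  reciprocal, so the last factor vanishes; if one part is empty, all degrees of the other are
  zero.\<close>

lemma bip_count_isolated_root:
  assumes fin: "finite A" "finite B" and ne: "A \<union> B \<noteq> {}" and K: "\<And>i. i \<in> A \<Longrightarrow> K i > 0"
    and x: "\<And>u. u \<in> A \<union> B \<Longrightarrow> x u = 0"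
  shows "bip_count A B K x = 0"
proof -
  consider "A = {}" | "B = {}" | "A \<noteq> {}" "B \<noteq> {}" by blast
  then show ?thesis
  proof cases
    case 3
    then have pos: "sum K A > 0" "card B > 0"
      using K fin by (auto simp: sum_pos card_gt_0_iff)
    have "(\<Sum>i\<in>A. (K i)\<^sup>2 / (x i + K i * card B)) = (\<Sum>i\<in>A. K i / card B)"
      using K x pos by (intro sum.cong) (auto simp: power2_eq_square field_simps)
    also have "\<dots> = sum K A / card B"
      by (simp add: sum_divide_distrib)
    finally have "(\<Sum>i\<in>A. (K i)\<^sup>2 / (x i + K i * card B)) * (\<Sum>j\<in>B. 1 / (x j + sum K A)) = 1"
      using x pos by simp
    then show ?thesis by (simp add: bip_count_def)
  qed (use ne x fin in \<open>auto simp: bip_count_def card_gt_0_iff\<close>)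
qed

section \<open>Counting spanning trees\<close>

text \<open>Contractions may leave loops, but one vertex stays connected without them, so only the
  empty edge set is minimal.\<close>

lemma num_spanning_trees_singleton:
  assumes "wf_multigraph G" "verts G = {r}"
  shows "num_spanning_trees G = 1"
proof -
  have conn: "mg_connected (G\<lparr>edges := T\<rparr>)" for T
    using assms(2) by (auto simp: mg_connected_def)
  have "is_tree (G\<lparr>edges := T\<rparr>) \<longleftrightarrow> T = {}" if "T \<subseteq> edges G" for T
  proof -
    have "wf_multigraph (G\<lparr>edges := T\<rparr>)"
      using assms(1) that by (auto simp: wf_multigraph_def)
    then show ?thesis
      using conn by (auto simp: is_tree_iff_minimally_connected del_edge_def)
  qed
  then have "spanning_trees G = {{}}"
    by (auto simp: spanning_trees_def)
  then show ?thesis by (simp add: num_spanning_trees_def)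
qed

lemma num_spanning_trees_isolated:
  assumes "r \<in> verts G" "u \<in> verts G" "u \<noteq> r"
    and "\<And>v e. e \<in> edges G \<Longrightarrow> ends G e = {r, v} \<Longrightarrow> v = r"
  shows "num_spanning_trees G = 0"
proof -
  have "\<not> is_tree (G\<lparr>edges := T\<rparr>)" if "T \<subseteq> edges G" for T
  proof
    assume "is_tree (G\<lparr>edges := T\<rparr>)"
    then have "(r, u) \<in> (adj_rel (G\<lparr>edges := T\<rparr>))\<^sup>*"
      using assms by (auto simp: is_tree_def mg_connected_def)
    then have "u = r"
      by (induction rule: rtrancl_induct) (use assms(4) that in \<open>auto simp: adj_rel_def\<close>)
    then show False using assms(3) by simp
  qed
  then have "spanning_trees G = {}"
    by (auto simp: spanning_trees_def)
  then show ?thesis by (simp add: num_spanning_trees_def)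
qed

theorem num_spanning_trees_cone:
  fixes G :: "('v, 'e) multigraph" and K :: "'v \<Rightarrow> nat"
  assumes "finite (edges G)" "wf_multigraph G"
    and "finite A" "finite B" "A \<inter> B = {}" "r \<notin> A \<union> B" "verts G = insert r (A \<union> B)"
    and "\<And>i. i \<in> A \<Longrightarrow> K i > 0"
    and "\<And>i j. i \<in> A \<Longrightarrow> j \<in> B \<Longrightarrow> mult G i j = K i"
    and "\<And>i j. i \<in> A \<Longrightarrow> j \<in> A \<Longrightarrow> mult G i j = 0"
    and "\<And>i j. i \<in> B \<Longrightarrow> j \<in> B \<Longrightarrow> mult G i j = 0"
  shows "real (num_spanning_trees G) = bip_count A B K (mult G r)"
  using assms
\<comment> \<open>Deletion keeps all vertices, so the edges are counted. The class is closed under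
  both operations because \<open>r\<close> may carry loops and arbitrary multiplicities.\<close>
proof (induction "card (edges G)" arbitrary: G A B rule: less_induct)
  case less
  note fin = less.prems(1,3,4) and wf = less.prems(2) and disj = less.prems(5)
    and r = less.prems(6) and V = less.prems(7) and K = less.prems(8)
    and AB = less.prems(9) and AA = less.prems(10) and BB = less.prems(11)
  show ?case
  proof (cases "\<exists>e v. e \<in> edges G \<and> ends G e = {r, v} \<and> v \<noteq> r")
    case False
    show ?thesis
    proof (cases "A \<union> B = {}")
      case True
      then show ?thesis
        using num_spanning_trees_singleton[OF wf, of r] V by (simp add: bip_count_def)
    next
      case ne: False
      then obtain u where "u \<in> A \<union> B" by blast
      then have "num_spanning_trees G = 0"
        using False V r by (intro num_spanning_trees_isolated[of r G u]) auto
      moreover have "mult G r v = 0" if "v \<in> A \<union> B" for v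
      proof -
        have "{e \<in> edges G. ends G e = {r, v}} = {}"
          using False that r by blast
        then show ?thesis by (metis mult_def card.empty)
      qed
      ultimately show ?thesis
        using bip_count_isolated_root[of A B K "mult G r"] fin ne K by simp
    qed
  next
    case True
    then obtain e v where e: "e \<in> edges G" "ends G e = {r, v}" and vr: "v \<noteq> r" by blast
    have v: "v \<in> A \<union> B"
      using wf e vr V by (force simp: wf_multigraph_def doubleton_eq_iff)
    let ?D = "del_edge e G" and ?C = "contract r v e G"
    have smaller: "card (edges ?D) < card (edges G)" "card (edges ?C) < card (edges G)"
      using card_Diff1_less[OF fin(1) e(1)] by simp_all
    have mD: "mult ?D a b = mult G a b" if "a \<noteq> r" "b \<noteq> r" for a b
      using mult_del_edge[OF fin(1) e, of a b] that by (auto simp: doubleton_eq_iff)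
    have mC: "mult ?C a b = mult G a b" if "a \<in> A \<union> B - {v}" "b \<in> A \<union> B - {v}" for a b
      using mult_contract_other[OF e(2), of a b] that r by auto
    have mCr: "mult ?C r u = mult G r u + mult G v u" if "u \<in> A \<union> B - {v}" for u
      using mult_contract_root[OF fin(1) wf e(2), of u] that r vr by auto
    \<comment> \<open>This makes the truncated subtraction in \<open>mult_del_edge\<close> agree
      with the real one in the step lemmas.\<close>
    have pos: "mult G r v \<ge> 1"
    proof -
      have "card {f \<in> edges G. ends G f = {r, v}} > 0"
        using e fin by (subst card_gt_0_iff) auto
      then show ?thesis by (simp add: mult_def)
    qed
    have ne: "a \<noteq> r" if "a \<in> A \<union> B" for a using that r by blast
    have "real (num_spanning_trees ?D) = bip_count A B K (mult ?D r)"
      by (rule less.hyps[OF smaller(1)])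
        (use fin wf disj r V K AB AA BB ne in \<open>auto simp: mD wf_multigraph_def\<close>)
    also have "\<dots> = bip_count A B K ((\<lambda>u. real (mult G r u))(v := real (mult G r v) - 1))"
      using pos mult_del_edge[OF fin(1) e, of r] vr
      by (intro bip_count_cong) (auto simp: doubleton_eq_iff)
    finally have D: "real (num_spanning_trees ?D) = \<dots>" .
    have wfC: "wf_multigraph ?C"
      using wf_contract[OF wf] V vr by simp
    have total: "real (num_spanning_trees G) =
        real (num_spanning_trees ?D) + real (num_spanning_trees ?C)"
      using num_spanning_trees_del_contract[OF fin(1) wf _ _ _ e] V v vr by auto
    show ?thesis
    proof (cases "v \<in> A")
      case True
      then have vB: "v \<notin> B" "\<And>u. u \<in> B \<Longrightarrow> u \<noteq> v" using disj by blast+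
      have "real (num_spanning_trees ?C) = bip_count (A - {v}) B K (mult ?C r)"
        by (rule less.hyps[OF smaller(2)])
          (use fin wfC disj r V K AB AA BB vB vr in \<open>auto simp: mC\<close>)
      \<comment> \<open>Vertices of \<open>A\<close> are not adjacent to \<open>v\<close>, so only
        those of \<open>B\<close> gain root edges, \<open>K v\<close> each.\<close>
      also have "\<dots> = bip_count (A - {v}) B K
          (\<lambda>u. if u \<in> B then real (mult G r u) + K v else real (mult G r u))"
        using AB AA True vB disj by (intro bip_count_cong) (auto simp: mCr)
      finally show ?thesis
        using bip_count_step_left[of A B v K "\<lambda>u. real (mult G r u)"] total D fin disj True K pos
        by simp
    next
      case False
      then have vB: "v \<in> B" and vA: "v \<notin> A" "\<And>u. u \<in> A \<Longrightarrow> u \<noteq> v" using v False by blast+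
      have "real (num_spanning_trees ?C) = bip_count A (B - {v}) K (mult ?C r)"
        by (rule less.hyps[OF smaller(2)])
          (use fin wfC disj r V K AB AA BB vA vr in \<open>auto simp: mC\<close>)
      \<comment> \<open>Now the gain is the weight \<open>K u\<close> of the other end;
        \<open>mult_sym\<close> puts the vertex of \<open>A\<close> first.\<close>
      also have "\<dots> = bip_count A (B - {v}) K
          (\<lambda>u. if u \<in> A then real (mult G r u) + K u else real (mult G r u))"
        using AB BB vA vB disj
        by (intro bip_count_cong) (auto simp: mCr mult_sym[of G v])
      finally show ?thesis
        using bip_count_step_right[of A B v K "\<lambda>u. real (mult G r u)"] total D fin disj vB K pos
        by simp
    qed
  qed
qed

text \<open>The identity \<open>b * K^2 / (k + K * b) = K - k * K / (k + K * b)\<close>, summed over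
  \<open>A\<close>, turns the last factor times \<open>sum K A\<close> into \<open>k\<close> times
  the required sum.\<close>

lemma bip_count_uniform_apex:
  assumes fin: "finite A" "finite B" and ne: "A \<noteq> {}" "B \<noteq> {}"
    and K: "\<And>i. i \<in> A \<Longrightarrow> K i > 0" and k: "k > 0"
    and x: "\<And>i. i \<in> A \<Longrightarrow> x i = k" "\<And>j. j \<in> B \<Longrightarrow> x j = 0"
  shows "bip_count A B K x = sum K A ^ (card B - 1) * k *
    (\<Prod>i\<in>A. k + K i * card B) * (\<Sum>i\<in>A. K i / (k + K i * card B))"
proof -
  let ?b = "real (card B)"
  define S where "S = (\<Sum>i\<in>A. (K i)\<^sup>2 / (k + K i * ?b))"
  have b: "card B > 0" using fin ne by (simp add: card_gt_0_iff)
  have s: "sum K A > 0" using fin ne K by (simp add: sum_pos)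
  have "?b * S = (\<Sum>i\<in>A. K i - k * (K i / (k + K i * ?b)))"
    unfolding S_def sum_distrib_left
  proof (intro sum.cong refl)
    fix i assume "i \<in> A"
    then have "k + K i * ?b > 0" using K k by (simp add: add_pos_nonneg less_imp_le)
    then show "?b * ((K i)\<^sup>2 / (k + K i * ?b)) = K i - k * (K i / (k + K i * ?b))"
      by (simp add: field_simps power2_eq_square)
  qed
  then have S: "sum K A - ?b * S = k * (\<Sum>i\<in>A. K i / (k + K i * ?b))"
    by (simp add: sum_subtractf sum_distrib_left)
  have "bip_count A B K x =
      (\<Prod>i\<in>A. k + K i * ?b) * sum K A ^ card B * (1 - S * (?b / sum K A))"
    using x by (simp add: bip_count_def S_def)
  \<comment> \<open>One factor \<open>sum K A\<close> leaves the power to clear the denominator in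
    the bracket.\<close>
  also have "\<dots> = (\<Prod>i\<in>A. k + K i * ?b) * sum K A ^ (card B - 1) * (sum K A - ?b * S)"
    using s by (subst power_eq_if) (use b in \<open>auto simp: field_simps\<close>)
  finally show ?thesis unfolding S by (simp add: mult_ac)
qed

section \<open>The half cone as a rooted complete bipartite graph\<close>

theorem theorem5p2:
  fixes k m n :: nat and ks :: "nat \<Rightarrow> nat"
  assumes "k \<ge> 1" and "m \<ge> 1" and "n \<ge> 1"
    and "\<And>i. i \<in> {1..m} \<Longrightarrow> ks i \<ge> 1"
  shows "real (num_spanning_trees (gen_half_cone k ks m n)) =
           (\<Sum>i=1..m. real (ks i)) ^ (n - 1) * real k *
           (\<Prod>i=1..m. real k + real (ks i) * real n) *
           (\<Sum>i=1..m. real (ks i) / (real k + real (ks i) * real n)) \<and>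
         (\<forall>s. (\<forall>i \<in> {1..m}. ks i = s) \<longrightarrow>
           num_spanning_trees (gen_half_cone k ks m n) =
             s ^ n * m ^ n * k * (k + s * n) ^ (m - 1))"
proof -
  let ?G = "gen_half_cone k ks m n" and ?A = "Q ` {1..m}" and ?B = "P ` {1..n}"
  \<comment> \<open>The root is \<open>Apex\<close>, and the \<open>Q\<close> vertices form the part
    that carries the weights.\<close>
  define K where "K = (\<lambda>u. case u of Q i \<Rightarrow> ks i | _ \<Rightarrow> 0)"
  have V: "verts ?G = insert Apex (?A \<union> ?B)"
    by (auto simp: gen_half_cone_def gen_complete_bipartite_def Let_def)
  have ends: "ends ?G (u, v, l) = {u, v}" for u v l
    by (simp add: gen_half_cone_def gen_complete_bipartite_def Let_def)
  have E: "(u, v, l) \<in> edges ?G \<longleftrightarrow>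
      (\<exists>i j. u = Q i \<and> v = P j \<and> i \<in> {1..m} \<and> j \<in> {1..n} \<and> l \<in> {1..ks i}) \<or>
      (\<exists>i. u = Apex \<and> v = Q i \<and> i \<in> {1..m} \<and> l \<in> {1..k})" for u v l
    by (auto simp: gen_half_cone_def gen_complete_bipartite_def Let_def)
  have "edges ?G \<subseteq> (\<lambda>(i, j, l). (Q i, P j, l)) ` (SIGMA i:{1..m}. {1..n} \<times> {1..ks i}) \<union>
      (\<lambda>(i, l). (Apex, Q i, l)) ` ({1..m} \<times> {1..k})"
    by (force simp: E)
  then have fin: "finite (edges ?G)"
    by (rule finite_subset) auto
  have wf: "wf_multigraph ?G"
    unfolding wf_multigraph_def V by (fastforce simp: E ends)
  have QP: "mult ?G (Q i) (P j) = ks i" if "i \<in> {1..m}" "j \<in> {1..n}" for i j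
  proof -
    have "{e \<in> edges ?G. ends ?G e = {Q i, P j}} = (\<lambda>l. (Q i, P j, l)) ` {1..ks i}"
      using that by (auto simp: E ends doubleton_eq_iff)
    then show ?thesis by (simp add: mult_def card_image inj_on_def)
  qed
  have AQ: "mult ?G Apex (Q i) = k" if "i \<in> {1..m}" for i
  proof -
    have "{e \<in> edges ?G. ends ?G e = {Apex, Q i}} = (\<lambda>l. (Apex, Q i, l)) ` {1..k}"
      using that by (auto simp: E ends doubleton_eq_iff)
    then show ?thesis by (simp add: mult_def card_image inj_on_def)
  qed
  \<comment> \<open>The first pair gives \<open>x = 0\<close> on the \<open>P\<close> side; the
    other two, with \<open>i = j\<close> included, exclude edges and loops inside a part.\<close>
  have zero: "mult ?G u v = 0"
    if "(u, v) \<in> {(Apex, P j), (Q i, Q j), (P i, P j)}" for u v i j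
  proof -
    have none: "{e \<in> edges ?G. ends ?G e = {u, v}} = {}"
      using that by (auto simp: E ends doubleton_eq_iff)
    show ?thesis unfolding mult_def none by simp
  qed
  have cardB: "card ?B = n" by (simp add: card_image inj_on_def)
  have injQ: "inj_on Q {1..m}" by (simp add: inj_on_def)
  have "real (num_spanning_trees ?G) = bip_count ?A ?B K (mult ?G Apex)"
  proof (rule num_spanning_trees_cone[OF fin wf _ _ _ _ V])
    show "K u > 0" if "u \<in> ?A" for u
      using that assms(4) by (auto simp: K_def Suc_le_eq)
    show "mult ?G u v = K u" if "u \<in> ?A" "v \<in> ?B" for u v
      using that QP by (auto simp: K_def)
    show "mult ?G u v = 0" if "u \<in> ?A" "v \<in> ?A" for u v
      using that by (auto intro: zero)
    show "mult ?G u v = 0" if "u \<in> ?B" "v \<in> ?B" for u v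
      using that by (auto intro: zero)
  qed auto
  also have "\<dots> = (\<Sum>u\<in>?A. real (K u)) ^ (n - 1) * real k * (\<Prod>u\<in>?A. real k + real (K u) * real n) *
      (\<Sum>u\<in>?A. real (K u) / (real k + real (K u) * real n))"
  proof (subst bip_count_uniform_apex[where k = k])
    show "real (K u) > 0" if "u \<in> ?A" for u
      using that assms(4) by (auto simp: K_def Suc_le_eq)
    show "real (mult ?G Apex u) = real k" if "u \<in> ?A" for u
      using that AQ by auto
    show "real (mult ?G Apex u) = 0" if "u \<in> ?B" for u
      using that by (auto intro: zero)
  qed (use assms cardB in auto)
  also have "\<dots> = (\<Sum>i=1..m. real (ks i)) ^ (n - 1) * real k *
           (\<Prod>i=1..m. real k + real (ks i) * real n) *
           (\<Sum>i=1..m. real (ks i) / (real k + real (ks i) * real n))"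
    unfolding sum.reindex[OF injQ] prod.reindex[OF injQ] by (simp add: K_def)
  finally have main: "real (num_spanning_trees ?G) = \<dots>" .
  have "num_spanning_trees ?G = s ^ n * m ^ n * k * (k + s * n) ^ (m - 1)"
    if s: "\<forall>i \<in> {1..m}. ks i = s" for s
  proof -
    obtain m' n' where mn: "m = Suc m'" "n = Suc n'"
      using assms(2,3) by (metis Suc_le_D One_nat_def)
    define d where "d = real k + real s * real n"
    have "d > 0" using assms(1) by (simp add: d_def add_pos_nonneg)
    \<comment> \<open>The \<open>m\<close> equal quotients sum to \<open>m * (s / d)\<close>: the
      factors \<open>m\<close> and \<open>s\<close> raise the exponent \<open>n'\<close> to
      \<open>n\<close>, and \<open>1 / d\<close> lowers that of \<open>d\<close> to
      \<open>m - 1\<close>.\<close>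
    have "real (num_spanning_trees ?G) =
        (real m * real s) ^ n' * real k * d ^ m * (real m * (real s / d))"
      unfolding main using s by (simp add: d_def mn)
    also have "\<dots> = real s ^ n * real m ^ n * real k * d ^ (m - 1)"
      using \<open>d > 0\<close> by (simp add: mn(2) power_mult_distrib) (simp add: mn(1))
    also have "\<dots> = real (s ^ n * m ^ n * k * (k + s * n) ^ (m - 1))"
      by (simp add: d_def)
    finally show ?thesis using of_nat_eq_iff by blast
  qed
  with main show ?thesis by blast
qed

end
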